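(* Let $P$ be a finite poset, $K$ a finite simplicial complex, $\mathsf{F} : P \to \mathsf{SubCx}(K)$ a filtration, and $\rho\ge 0$ an integer. Let $(b,d)\in\mathsf{Seg}(P)$ and let $z\in \mathsf{OI}(\mathsf{ZB}_\rho^{\mathsf{F}})((b,d))$ be a nonzero cycle. Then $z$ is born precisely at $b$ and dies precisely at $d$, i.e. $z$ has lifespan $(b,d)$.
   Context: Segments: $\mathsf{Seg}(P)$ consists of all pairs $(b,d)$ with $b\le d$ in $P$ (including $(a,a)$) together with a pair $(a,\infty)$ for each $a\in P$. The product order is $(b_1,d_1)\le_\times(b_2,d_2)\iff b_1\le b_2$ and $d_1\le d_2$, where $p<\infty$ for all $p\in P$. Chains: for a finite simplicial complex $K$ over a finite totally ordered vertex set, $C_\rho^K$ is the real vector space with basis the oriented $\rho$-simplices of $K$ (oriented by the vertex order), with the inner product making this basis orthonormal, and the usual simplicial boundary operators. For a subcomplex $L\subseteq K$, $\mathsf{Z}_\rho(L)$ and $\mathsf{B}_\rho(L)$ are the spaces of $\rho$-cycles and $\rho$-boundaries of $L$, viewed as subspaces of $C_\rho^K$. $\mathsf{SubCx}(K)$ is the poset of subcomplexes of $K$ under inclusion; a filtration is an order-preserving map $\mathsf{F}:P\to\mathsf{SubCx}(K)$. Birth-death spaces: $\mathsf{ZB}_\rho^{\mathsf{F}}((b,d)) := \mathsf{Z}_\rho(\mathsf{F}(b))\cap\mathsf{B}_\rho(\mathsf{F}(d))$ for $b\le d$ in $P$, and $\mathsf{ZB}_\rho^{\mathsf{F}}((b,\infty))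 := \mathsf{Z}_\rho(\mathsf{F}(b))$. Orthogonal Inverse: $\mathsf{OI}(\mathsf{ZB}_\rho^{\mathsf{F}})((b,d)) := \mathsf{ZB}_\rho^{\mathsf{F}}((b,d))\cap\big(W_\rho^{\mathsf{F}}((b,d))\big)^\perp$, where $W_\rho^{\mathsf{F}}((b,d)) := \sum_{(a,c)<_\times(b,d)}\mathsf{ZB}_\rho^{\mathsf{F}}((a,c))$ (empty sum is $\{0\}$) and $\perp$ is taken in $C_\rho^K$. Lifespan: a nonzero cycle $z\in C_\rho^K$ has lifespan $(b,d)$ (is born precisely at $b$ and dies precisely at $d$) if $z\in\mathsf{ZB}_\rho^{\mathsf{F}}((b,d))$ and $z\notin W_\rho^{\mathsf{F}}((b,d))$. *)

theory Defs
  imports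
    "HOL-Analysis.Analysis"
    "HOL-Library.Set_Algebras"
    "HOL-Library.Product_Order"
    "HOL-Library.Lattice_Constructions"
begin

section \<open>Simplicial complexes and filtrations\<close>

text \<open>
  The vertices form a type of class \<open>{finite, linorder}\<close>, so every complex below is automatically
  finite. A vertex need not belong to the complex. The empty set is not a simplex.
\<close>

definition abstract_complex :: "'v set set \<Rightarrow> bool" where
  "abstract_complex K \<longleftrightarrow>
     {} \<notin> K \<and> (\<forall>\<sigma>\<in>K. \<forall>\<tau>. \<tau> \<subseteq> \<sigma> \<and> \<tau> \<noteq> {} \<longrightarrow> \<tau> \<in> K)"

definition SubCx :: "'v set set \<Rightarrow> 'v set set set" where
  "SubCx K = {L. L \<subseteq> K \<and> abstract_complex L}"

definition filtration :: "'v set set \<Rightarrow> ('p::order \<Rightarrow> 'v set set) \<Rightarrow> bool" where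
  "filtration K F \<longleftrightarrow> range F \<subseteq> SubCx K \<and> mono F"


section \<open>Chains, cycles and boundaries\<close>

text \<open>
  Chains of all complexes and degrees live in the Euclidean space \<open>real ^ 'v set\<close>, whose standard
  basis vectors \<open>axis \<sigma> 1\<close> are orthonormal. For a simplex \<open>\<sigma>\<close> this vector stands for \<open>\<sigma>\<close> oriented by
  the vertex order. The library inner product thus restricts to the intended one on
  \<open>chains r K\<close>, and the chains of a subcomplex are literally a subspace of those of \<open>K\<close>.
\<close>

definition chains :: "nat \<Rightarrow> 'v::finite set set \<Rightarrow> (real ^ 'v set) set" where
  "chains r L = span {axis \<sigma> 1 |\<sigma>. \<sigma> \<in> L \<and> card \<sigma> = Suc r}"

text \<open>
  If \<open>v\<close> is the \<open>i\<close>-th vertex of \<open>\<sigma>\<close> (counting from 0 in the vertex order), then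
  \<open>card {u \<in> \<sigma>. u < v} = i\<close>, so this is the usual sum of \<open>(-1) ^ i\<close> times the \<open>i\<close>-th face of \<open>\<sigma>\<close>.
\<close>

definition boundary_simplex :: "'v::{finite,linorder} set \<Rightarrow> real ^ 'v set" where
  "boundary_simplex \<sigma> = (\<Sum>v\<in>\<sigma>. axis (\<sigma> - {v}) ((-1) ^ card {u \<in> \<sigma>. u < v}))"

text \<open>
  The linear extension to \<open>r\<close>-chains. Homology is not reduced: the boundary of a \<open>0\<close>-chain is \<open>0\<close>.
\<close>

definition boundary :: "nat \<Rightarrow> real ^ 'v::{finite,linorder} set \<Rightarrow> real ^ 'v set" where
  "boundary r c =
     (if r = 0 then 0 else \<Sum>\<sigma> | card \<sigma> = Suc r. (c $ \<sigma>) *\<^sub>R boundary_simplex \<sigma>)"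

definition cycles :: "nat \<Rightarrow> 'v::{finite,linorder} set set \<Rightarrow> (real ^ 'v set) set" where
  "cycles r L = {c \<in> chains r L. boundary r c = 0}"

definition boundaries :: "nat \<Rightarrow> 'v::{finite,linorder} set set \<Rightarrow> (real ^ 'v set) set" where
  "boundaries r L = boundary (Suc r) ` chains (Suc r) L"


section \<open>Segments and birth-death spaces\<close>

text \<open>
  The type \<open>'p top\<close> adjoins a greatest element, which plays the role of \<open>\<infinity>\<close>. The order on pairs
  is the componentwise one, so \<open><\<close> on pairs is the strict part of the product order.
\<close>

definition Seg :: "('p::order \<times> 'p top) set" where
  "Seg = {(b, top.Value d) |b d. b \<le> d} \<union> {(a, top.Top) |a. True}"

definition ZB ::
  "nat \<Rightarrow> ('p \<Rightarrow> 'v::{finite,linorder} set set) \<Rightarrow> 'p \<times> 'p top \<Rightarrow> (real ^ 'v set) set" where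
  "ZB r F s = (case s of (b, e) \<Rightarrow>
     (case e of top.Value d \<Rightarrow> cycles r (F b) \<inter> boundaries r (F d)
              | top.Top \<Rightarrow> cycles r (F b)))"

text \<open>
  The sum below adds sets elementwise (Minkowski sum), that is, it is a sum of subspaces; the
  empty sum is \<open>{0}\<close>. The index set has to be finite for this to be meaningful, which
  \<open>finite_Seg\<close> ensures.
\<close>

lemma finite_Seg: "finite (Seg :: ('p::{finite,order} \<times> 'p top) set)"
proof (rule finite_subset)
  show "(Seg :: ('p \<times> 'p top) set) \<subseteq> UNIV \<times> insert top.Top (range top.Value)"
    by (auto simp: Seg_def)
qed simp

definition W ::
  "nat \<Rightarrow> ('p::{finite,order} \<Rightarrow> 'v::{finite,linorder} set set) \<Rightarrow> 'p \<times> 'p top \<Rightarrow>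
     (real ^ 'v set) set" where
  "W r F s = (\<Sum>t\<in>{t \<in> Seg. t < s}. ZB r F t)"

definition OI ::
  "nat \<Rightarrow> 'v::{finite,linorder} set set \<Rightarrow> ('p::{finite,order} \<Rightarrow> 'v set set) \<Rightarrow> 'p \<times> 'p top \<Rightarrow>
     (real ^ 'v set) set" where
  "OI r K F s = ZB r F s \<inter> (chains r K \<inter> orthogonal_comp (W r F s))"

definition has_lifespan ::
  "nat \<Rightarrow> 'v::{finite,linorder} set set \<Rightarrow> ('p::{finite,order} \<Rightarrow> 'v set set) \<Rightarrow> real ^ 'v set \<Rightarrow>
     'p \<times> 'p top \<Rightarrow> bool" where
  "has_lifespan r K F z s \<longleftrightarrow>
     z \<in> cycles r K \<and> z \<noteq> 0 \<and> z \<in> ZB r F s \<and> z \<notin> W r F s"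

end

theory Submission
  imports Defs
begin

text \<open>
  Of the conditions making up a lifespan, the only one that is not immediate from the definition
  of \<open>OI\<close> is \<open>z \<notin> W \<rho> F (b, d)\<close>: the cycle must not be a sum of cycles of strictly earlier
  segments. But \<open>z\<close> is orthogonal to all such sums, and a vector orthogonal to a set containing it
  is orthogonal to itself, hence \<open>0\<close>. This is lemma \<open>mem_orthogonal_comp_imp_eq_0\<close>. That \<open>z\<close> is a
  cycle of \<open>K\<close> holds because the boundary operator of a subcomplex is the restriction of the one of
  \<open>K\<close>, and \<open>OI\<close> takes the orthogonal complement inside the chains of \<open>K\<close>.
\<close>

lemma mem_orthogonal_comp_imp_eq_0:
  assumes "x \<in> S" and "x \<in> orthogonal_comp S"
  shows "x = 0"
  using assms by (auto simp: orthogonal_comp_def orthogonal_self)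

lemma ZB_subset_cycles: "ZB r F (b, d) \<subseteq> cycles r (F b)"
  by (auto simp: ZB_def split: top.splits)

theorem theorem5:
  fixes K :: "'v::{finite,linorder} set set"
    and F :: "'p::{finite,order} \<Rightarrow> 'v set set"
    and \<rho> :: nat
    and b :: 'p and d :: "'p top"
    and z :: "real ^ 'v set"
  assumes "abstract_complex K"
    and "filtration K F"
    and "(b, d) \<in> Seg"
    and "z \<in> OI \<rho> K F (b, d)"
    and "z \<noteq> 0"
  shows "has_lifespan \<rho> K F z (b, d)"
proof -
  from assms(4) have ZB: "z \<in> ZB \<rho> F (b, d)" and chain: "z \<in> chains \<rho> K"
    and orth: "z \<in> orthogonal_comp (W \<rho> F (b, d))"
    by (auto simp: OI_def)
  have "z \<in> cycles \<rho> K"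
    using ZB ZB_subset_cycles chain by (fastforce simp: cycles_def)
  moreover have "z \<notin> W \<rho> F (b, d)"
    using mem_orthogonal_comp_imp_eq_0 orth \<open>z \<noteq> 0\<close> by blast
  ultimately show ?thesis
    using ZB \<open>z \<noteq> 0\<close> by (simp add: has_lifespan_def)
qed

end
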